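(* Let $(\mathcal{X},\rho)$ be a metric space, let $X=\{x_1,\dots,x_n\}\subseteq\mathcal{X}$ be a dataset of $n$ points, and let $k$ be an even integer with $k\le n/3$. Run the algorithm MWMOffline described in the context on input $(X,k)$. Then, with high probability, it outputs a set $Z\subseteq X$ with $|Z|=k$ that is an $O(1)$-approximation for remote-matching: there is an absolute constant $c>0$ (independent of $X$, $n$, $k$ and the metric) such that $\mathrm{MWM}(Z)\ge c\cdot \mathrm{MWM}_k(X)$.
   Context: For a finite set $Y$ of even size, $\mathrm{MWM}(Y)$ denotes the minimum total weight $\sum_{\{a,b\}\in M}\rho(a,b)$ over all perfect matchings $M$ of $Y$ (with $\mathrm{MWM}(\emptyset)=0$). For a dataset $X$ and even $k$, the remote-matching value is $\mathrm{MWM}_k(X)=\max_{Y\subseteq X,\,|Y|=k}\mathrm{MWM}(Y)$. For a point $x$ and a set $S$, $\rho(x,S)=\min_{s\in S}\rho(x,s)$. The GMM algorithm on input $(X,k)$: pick an arbitrary $y_1\in X$; for $p=2,\dots,k$, let $y_p$ be a point of $X$ maximizing $\rho(y,\{y_1,\dots,y_{p-1}\})$ over $y\in X$; output $Y=\{y_1,\dots,y_k\}$. Algorithm MWMOffline on input $(X,k)$: (1) compute $Y=\{y_1,\dots,y_k\}$ by GMM; (2) partition $X$ into $S_1,\dots,S_k$, putting $x$ into $S_j$ where $y_j$ is a closest point of $Y$ to $x$ (ties broken arbitrarily); (3) let $Z$ be a uniformly random subset of $Y$ (each element included independently with probability $1/2$), and if $|Z|$ is odd remove an arbitrary element from it;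 (4) set $W\leftarrow Z$, and while $|W|<k$, find two points $x,x'\in X\setminus(W\cup Y)$ lying in the same part $S_j$ and add both to $W$; (5) return whichever of $Y$ and $W$ has larger minimum-weight matching cost.
   Formalization: One run cannot succeed with high probability (it can fail with probability at least 1/4), so this is replaced by success probability at least 1/4 for one run and 1-(3/4)^t for the best of t independent runs; c is stated per type of points, and k=0 with X nonempty has no run. *)

theory Defs
  imports "HOL-Probability.Probability"
begin

definition perfect_matching :: "'a set \<Rightarrow> 'a set set \<Rightarrow> bool" where
  "perfect_matching Y M \<longleftrightarrow> partition_on Y M \<and> (\<forall>e\<in>M. card e = 2)"

definition edge_weight :: "('a \<Rightarrow> 'a \<Rightarrow> real) \<Rightarrow> 'a set \<Rightarrow> real" where
  "edge_weight d e = (THE w. \<exists>a b. a \<noteq> b \<and> e = {a, b} \<and> w = d a b)"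

definition MWM :: "('a \<Rightarrow> 'a \<Rightarrow> real) \<Rightarrow> 'a set \<Rightarrow> real" where
  "MWM d Y = Min {(\<Sum>e\<in>M. edge_weight d e) | M. perfect_matching Y M}"

definition remote_matching :: "('a \<Rightarrow> 'a \<Rightarrow> real) \<Rightarrow> nat \<Rightarrow> 'a set \<Rightarrow> real" where
  "remote_matching d k X = Max {MWM d Y | Y. Y \<subseteq> X \<and> card Y = k}"

definition point_set_dist :: "('a \<Rightarrow> 'a \<Rightarrow> real) \<Rightarrow> 'a \<Rightarrow> 'a set \<Rightarrow> real" where
  "point_set_dist d x S = Min {d x s | s. s \<in> S}"

text \<open>
  The possible results of GMM, as the list of the points in the order in which they are picked:
  the first one is arbitrary, every later one is a farthest point from its predecessors.
\<close>

definition gmm_output :: "('a \<Rightarrow> 'a \<Rightarrow> real) \<Rightarrow> 'a set \<Rightarrow> nat \<Rightarrow> 'a list \<Rightarrow> bool" where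
  "gmm_output d X k ys \<longleftrightarrow> length ys = k \<and> set ys \<subseteq> X \<and>
     (\<forall>p. 1 \<le> p \<and> p < k \<longrightarrow>
        is_arg_max (\<lambda>y. point_set_dist d y (set (take p ys))) (\<lambda>y. y \<in> X) (ys ! p))"

text \<open>
  A resolution of all the arbitrary choices of MWMOffline. The part \<open>S\<^sub>j\<close> consists of the points
  \<open>x\<close> with \<open>part_of ch x = j\<close>, where \<open>j\<close> is a position in the list \<open>gmm_seq ch\<close>. The choices made
  after the random subset \<open>Z\<close> has been drawn may depend on it: \<open>dropped ch Z\<close> is the element
  removed from \<open>Z\<close> if \<open>card Z\<close> is odd, and \<open>pair ch Z W\<close> is the pair of points found by the loop
  when the current set is \<open>W\<close>.
\<close>

record 'a choices =
  gmm_seq :: "'a list"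
  part_of :: "'a \<Rightarrow> nat"
  dropped :: "'a set \<Rightarrow> 'a"
  pair :: "'a set \<Rightarrow> 'a set \<Rightarrow> 'a \<times> 'a"

definition gmm_set :: "'a choices \<Rightarrow> 'a set" where
  "gmm_set ch = set (gmm_seq ch)"

definition addable :: "'a set \<Rightarrow> 'a choices \<Rightarrow> 'a set \<Rightarrow> 'a \<times> 'a \<Rightarrow> bool" where
  "addable X ch W p \<longleftrightarrow> fst p \<noteq> snd p \<and>
     fst p \<in> X - (W \<union> gmm_set ch) \<and> snd p \<in> X - (W \<union> gmm_set ch) \<and>
     part_of ch (fst p) = part_of ch (snd p)"

definition valid_choices :: "('a \<Rightarrow> 'a \<Rightarrow> real) \<Rightarrow> 'a set \<Rightarrow> nat \<Rightarrow> 'a choices \<Rightarrow> bool" where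
  "valid_choices d X k ch \<longleftrightarrow>
     gmm_output d X k (gmm_seq ch) \<and>
     (\<forall>x\<in>X. is_arg_min (\<lambda>j. d x (gmm_seq ch ! j)) (\<lambda>j. j < k) (part_of ch x)) \<and>
     (\<forall>Z. Z \<subseteq> gmm_set ch \<and> odd (card Z) \<longrightarrow> dropped ch Z \<in> Z) \<and>
     (\<forall>Z W. (\<exists>p. addable X ch W p) \<longrightarrow> addable X ch W (pair ch Z W))"

definition make_even :: "'a choices \<Rightarrow> 'a set \<Rightarrow> 'a set" where
  "make_even ch Z = (if odd (card Z) then Z - {dropped ch Z} else Z)"

text \<open>The result is \<open>None\<close> if the loop gets stuck because no suitable pair exists.\<close>

partial_function (option) fill_up ::
  "'a set \<Rightarrow> nat \<Rightarrow> 'a choices \<Rightarrow> 'a set \<Rightarrow> 'a set \<Rightarrow> 'a set option" where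
  "fill_up X k ch Z W =
     (if card W < k then
        if addable X ch W (pair ch Z W)
        then fill_up X k ch Z (W \<union> {fst (pair ch Z W), snd (pair ch Z W)})
        else None
      else Some W)"

definition better :: "('a \<Rightarrow> 'a \<Rightarrow> real) \<Rightarrow> 'a set \<Rightarrow> 'a set \<Rightarrow> 'a set" where
  "better d A B = (if MWM d B \<le> MWM d A then A else B)"

definition MWMOffline ::
  "('a \<Rightarrow> 'a \<Rightarrow> real) \<Rightarrow> 'a set \<Rightarrow> nat \<Rightarrow> 'a choices \<Rightarrow> 'a set option pmf" where
  "MWMOffline d X k ch =
     do {
       Z \<leftarrow> pmf_of_set (Pow (gmm_set ch));
       return_pmf (map_option (better d (gmm_set ch)) (fill_up X k ch Z (make_even ch Z)))
     }"

fun better_output ::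
  "('a \<Rightarrow> 'a \<Rightarrow> real) \<Rightarrow> 'a set option \<Rightarrow> 'a set option \<Rightarrow> 'a set option" where
  "better_output d (Some A) (Some B) = Some (better d A B)"
| "better_output d A None = A"
| "better_output d None B = B"

text \<open>
  The best output of \<open>t\<close> independent runs of MWMOffline, the \<open>i\<close>-th of which makes the
  choices \<open>chs i\<close>.
\<close>

primrec MWMOffline_repeated ::
  "('a \<Rightarrow> 'a \<Rightarrow> real) \<Rightarrow> 'a set \<Rightarrow> nat \<Rightarrow> (nat \<Rightarrow> 'a choices) \<Rightarrow> nat \<Rightarrow> 'a set option pmf" where
  "MWMOffline_repeated d X k chs 0 = return_pmf None"
| "MWMOffline_repeated d X k chs (Suc t) =
     do {
       A \<leftarrow> MWMOffline_repeated d X k chs t;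
       B \<leftarrow> MWMOffline d X k (chs t);
       return_pmf (better_output d A B)
     }"

text \<open>
  The outcomes in which a set of \<open>k\<close> points of \<open>X\<close> is returned whose matching cost is at least
  \<open>c\<close> times the remote-matching value.
\<close>

definition approx_outputs ::
  "('a \<Rightarrow> 'a \<Rightarrow> real) \<Rightarrow> 'a set \<Rightarrow> nat \<Rightarrow> real \<Rightarrow> 'a set option set" where
  "approx_outputs d X k c =
     {Some Z | Z. Z \<subseteq> X \<and> card Z = k \<and> MWM d Z \<ge> c * remote_matching d k X}"

end

theory Submission
  imports Defs
begin

text \<open>
  The minimum matching cost is subadditive under symmetric difference, by exchanging one edge at
  a time. Let \<open>Y\<close> be the output of GMM. There is a radius \<open>r\<close> such that the points of \<open>Y\<close> are at
  distance at least \<open>r\<close> from each other and every point of \<open>X\<close> is within \<open>r\<close> of \<open>Y\<close>; in particular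
  \<open>k r \<le> 2 MWM(Y)\<close>. Moving an optimal set to the nearest centres and cancelling in pairs gives an
  even \<open>Q \<subseteq> Y\<close> with \<open>OPT \<le> MWM(Q) + k r\<close>. For a uniformly random even \<open>Z \<subseteq> Y\<close>, the set
  \<open>Z \<triangle> Q\<close> has the same distribution, and \<open>MWM(Q) \<le> MWM(Z) + MWM(Z \<triangle> Q)\<close>, so
  \<open>MWM(Z) \<ge> MWM(Q) / 2\<close> with probability at least \<open>1 / 2\<close>; as \<open>Z\<close> is even with probability at
  least \<open>1 / 2\<close>, this gives \<open>1 / 4\<close>. Each pair added by the loop has length at most \<open>2 r\<close>, whence
  \<open>MWM(Z) \<le> MWM(W) + k r\<close>. Altogether \<open>OPT \<le> 8 max(MWM(Y), MWM(W))\<close>.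
\<close>

section \<open>Parity of symmetric differences and counting of even subsets\<close>

lemma even_card_sym_diff:
  assumes "finite A" "finite B"
  shows "even (card (sym_diff A B)) \<longleftrightarrow> (even (card A) \<longleftrightarrow> even (card B))"
proof -
  have "card (sym_diff A B) = card (A - B) + card (B - A)"
    using assms by (intro card_Un_disjoint) auto
  moreover have "card A = card (A - B) + card (A \<inter> B)"
    using assms card_Int_Diff[of A B] by simp
  moreover have "card B = card (B - A) + card (A \<inter> B)"
    using assms card_Int_Diff[of B A] by (simp add: Int_commute)
  ultimately show ?thesis
    by presburger
qed

lemma card_remove_pair:
  assumes "finite S" "a \<in> S" "b \<in> S" "a \<noteq> b"
  shows "card S = card (S - {a, b}) + 2"
  using assms card_mono[of S "{a, b}"] by (simp add: card_Diff_subset)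

lemma even_card_remove_pair:
  assumes "finite S" "a \<in> S" "b \<in> S" "a \<noteq> b"
  shows "even (card (S - {a, b})) \<longleftrightarrow> even (card S)"
  unfolding card_remove_pair[OF assms] by simp

text \<open>
  Half of the subsets of \<open>Y\<close> are even, and the involution \<open>Z \<mapsto> sym_diff Z Q\<close> of the even subsets
  shows that at least half of these are good.
\<close>

lemma card_good_subsets_ge:
  assumes Y: "finite Y" and Q: "Q \<subseteq> Y" "even (card Q)"
    and good: "\<And>Z. Z \<subseteq> Y \<Longrightarrow> even (card Z) \<Longrightarrow> P Z \<or> P (sym_diff Z Q)"
  shows "2 ^ card Y \<le> 4 * card {Z. Z \<subseteq> Y \<and> even (card Z) \<and> P Z}"
proof -
  define E where "E = {Z. Z \<subseteq> Y \<and> even (card Z)}"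
  define G where "G = {Z. Z \<subseteq> Y \<and> even (card Z) \<and> P Z}"
  have fin: "finite E" "finite G"
    using Y by (auto simp: E_def G_def)
  have finQ: "finite Q"
    using Y Q(1) finite_subset by blast
  have toggle: "sym_diff (sym_diff Z A) A = Z" for Z A :: "'a set"
    by auto
  have "card (Pow Y) \<le> 2 * card E"
  proof (cases "Y = {}")
    case True
    then have "E = {{}}"
      by (auto simp: E_def)
    then show ?thesis
      using True by simp
  next
    case False
    then obtain y where y: "y \<in> Y" by auto
    \<comment> \<open>Toggling the membership of one fixed \<open>y\<close> flips the parity, so
      every odd subset is the image of an even one.\<close>
    have "Z \<in> E \<union> (\<lambda>Z. sym_diff Z {y}) ` E" if Z: "Z \<subseteq> Y" for Z
    proof (cases "even (card Z)")
      case True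
      then show ?thesis
        using Z by (simp add: E_def)
    next
      case odd: False
      have "finite Z"
        using Z Y finite_subset by blast
      then have "sym_diff Z {y} \<in> E"
        using Z y odd even_card_sym_diff[of Z "{y}"] by (auto simp: E_def)
      then show ?thesis
        by (intro UnI2, rule image_eqI[where x = "sym_diff Z {y}", rotated]) (simp only: toggle)
    qed
    then have "card (Pow Y) \<le> card (E \<union> (\<lambda>Z. sym_diff Z {y}) ` E)"
      using fin by (intro card_mono) auto
    also have "\<dots> \<le> card E + card E"
      using card_Un_le card_image_le[OF fin(1)] by (meson add_left_mono order_trans)
    finally show ?thesis by simp
  qed
  moreover have "card E \<le> 2 * card G"
  proof -
    have "Z \<in> G \<union> (\<lambda>Z. sym_diff Z Q) ` G" if Z: "Z \<in> E" for Z
    proof (cases "P Z")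
      case True
      then show ?thesis
        using Z by (simp add: E_def G_def)
    next
      case False
      have "finite Z"
        using Z Y finite_subset unfolding E_def by blast
      then have "sym_diff Z Q \<in> G"
        using Z False good[of Z] Q finQ even_card_sym_diff[of Z Q] by (auto simp: E_def G_def)
      then show ?thesis
        by (intro UnI2, rule image_eqI[where x = "sym_diff Z Q", rotated]) (simp only: toggle)
    qed
    then have "card E \<le> card (G \<union> (\<lambda>Z. sym_diff Z Q) ` G)"
      using fin by (intro card_mono) auto
    also have "\<dots> \<le> card G + card G"
      using card_Un_le card_image_le[OF fin(2)] by (meson add_left_mono order_trans)
    finally show ?thesis by simp
  qed
  ultimately show ?thesis
    using Y by (simp add: card_Pow G_def)
qed

section \<open>Minimum-weight perfect matchings\<close>

context Metric_space
begin

text \<open>Symmetry of the metric makes the weight independent of the order of the endpoints, so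
  the definite description is well defined.\<close>

lemma edge_weight_pair: "a \<noteq> b \<Longrightarrow> edge_weight d {a, b} = d a b"
  unfolding edge_weight_def by (rule the_equality) (auto simp: doubleton_eq_iff commute)

lemma perfect_matching_insert:
  assumes "perfect_matching S N" "a \<noteq> b" "a \<notin> S" "b \<notin> S"
  shows "perfect_matching (insert a (insert b S)) (insert {a, b} N)" "{a, b} \<notin> N"
proof -
  have S: "S = \<Union>N"
    using assms(1) by (auto simp: perfect_matching_def partition_on_def)
  have "disjnt {a, b} (\<Union>N)"
    using assms S by (auto simp: disjnt_iff)
  moreover have "insert a (insert b S) - {a, b} = S"
    using assms by auto
  ultimately show "perfect_matching (insert a (insert b S)) (insert {a, b} N)"
    using assms by (simp add: perfect_matching_def partition_on_insert)
  show "{a, b} \<notin> N"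
    using assms S by auto
qed

lemma perfect_matching_remove:
  assumes "perfect_matching S N" "a \<in> S"
  obtains b where "b \<in> S" "b \<noteq> a" "{a, b} \<in> N" "perfect_matching (S - {a, b}) (N - {{a, b}})"
proof -
  have part: "partition_on S N" and two: "\<forall>e\<in>N. card e = 2"
    using assms(1) by (auto simp: perfect_matching_def)
  obtain e where e: "e \<in> N" "a \<in> e"
    using part assms(2) by (auto simp: partition_on_def)
  moreover obtain u v where "e = {u, v}" "u \<noteq> v"
    using two e by (meson card_2_iff)
  ultimately obtain b where b: "e = {a, b}" "b \<noteq> a"
    by (metis doubleton_eq_iff insertE singletonD)
  have "disjnt e (\<Union>(N - {e}))"
    using part e by (auto simp: partition_on_def disjoint_def disjnt_def)
  then have "partition_on (S - e) (N - {e}) \<and> e \<subseteq> S"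
    using partition_on_insert[of e "N - {e}" S] part e by (simp add: insert_absorb)
  with b two e show thesis
    by (intro that[of b]) (auto simp: perfect_matching_def)
qed

lemma perfect_matching_ex:
  assumes "finite S" "even (card S)"
  shows "\<exists>N. perfect_matching S N"
  using assms
proof (induction "card S" arbitrary: S rule: less_induct)
  case less
  show ?case
  proof (cases "S = {}")
    case True
    then have "perfect_matching S {}"
      by (simp add: perfect_matching_def partition_on_empty)
    then show ?thesis ..
  next
    case False
    then obtain a where a: "a \<in> S" by auto
    have "S \<noteq> {a}"
      using less.prems by auto
    then obtain b where b: "b \<in> S" "b \<noteq> a"
      using a by auto
    have "card S = card (S - {a, b}) + 2"
      using a b less.prems by (intro card_remove_pair) auto
    then obtain N where "perfect_matching (S - {a, b}) N"
      using less.hyps[of "S - {a, b}"] less.prems by auto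
    then have "perfect_matching (insert a (insert b (S - {a, b}))) (insert {a, b} N)"
      using b by (intro perfect_matching_insert) auto
    moreover have "insert a (insert b (S - {a, b})) = S"
      using a b by auto
    ultimately show ?thesis by metis
  qed
qed

lemma finite_perfect_matching: "finite S \<Longrightarrow> perfect_matching S N \<Longrightarrow> finite N"
  by (meson finite_elements perfect_matching_def)

lemma finite_perfect_matchings:
  assumes "finite S"
  shows "finite {N. perfect_matching S N}"
proof (rule finite_subset)
  show "{N. perfect_matching S N} \<subseteq> Pow (Pow S)"
    by (auto simp: perfect_matching_def partition_on_def)
qed (use assms in simp)

lemma MWM_le:
  assumes "finite S" "perfect_matching S N"
  shows "MWM d S \<le> (\<Sum>e\<in>N. edge_weight d e)"
  unfolding MWM_def
  using assms finite_perfect_matchings[OF assms(1)] by (intro Min_le) auto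

lemma MWM_attained:
  assumes "finite S" "even (card S)"
  obtains N where "perfect_matching S N" "MWM d S = (\<Sum>e\<in>N. edge_weight d e)"
proof -
  have "MWM d S \<in> {(\<Sum>e\<in>N. edge_weight d e) | N. perfect_matching S N}"
    unfolding MWM_def
    using assms finite_perfect_matchings[OF assms(1)] perfect_matching_ex[OF assms]
    by (intro Min_in) auto
  then show thesis
    using that by auto
qed

lemma MWM_empty [simp]: "MWM d {} = 0"
  by (rule MWM_attained[of "{}"]) (auto simp: perfect_matching_def partition_on_empty)

section \<open>Changing a set by one edge, and subadditivity under symmetric difference\<close>

lemma MWM_insert_le:
  assumes "finite S" "even (card S)" "a \<noteq> b" "a \<notin> S" "b \<notin> S"
  shows "MWM d (insert a (insert b S)) \<le> MWM d S + d a b"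
proof -
  obtain N where N: "perfect_matching S N" "MWM d S = (\<Sum>e\<in>N. edge_weight d e)"
    using MWM_attained assms by metis
  note insert = perfect_matching_insert[OF N(1) assms(3-5)]
  have "MWM d (insert a (insert b S)) \<le> (\<Sum>e\<in>insert {a, b} N. edge_weight d e)"
    using assms insert by (intro MWM_le) auto
  also have "\<dots> = MWM d S + d a b"
    using N insert assms finite_perfect_matching[OF assms(1) N(1)] by (simp add: edge_weight_pair)
  finally show ?thesis .
qed

text \<open>Take \<open>b\<close> to be the partner of \<open>a\<close> in an optimal matching. The
  later inductions peel off edges through this fact and never handle matchings explicitly.\<close>

lemma MWM_remove:
  assumes "finite S" "even (card S)" "a \<in> S"
  obtains b where "b \<in> S" "b \<noteq> a" "MWM d (S - {a, b}) + d a b \<le> MWM d S"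
proof -
  obtain N where N: "perfect_matching S N" "MWM d S = (\<Sum>e\<in>N. edge_weight d e)"
    using MWM_attained assms by metis
  obtain b where b: "b \<in> S" "b \<noteq> a" "{a, b} \<in> N" "perfect_matching (S - {a, b}) (N - {{a, b}})"
    using perfect_matching_remove N assms by metis
  have "MWM d (S - {a, b}) \<le> (\<Sum>e\<in>N - {{a, b}}. edge_weight d e)"
    using assms b by (intro MWM_le) auto
  also have "\<dots> = MWM d S - d a b"
    using N b assms finite_perfect_matching[OF assms(1) N(1)] by (simp add: sum_diff1 edge_weight_pair)
  finally show thesis
    using b that by auto
qed

text \<open>Here \<open>a\<close> is traded for \<open>b\<close>: the former partner
  \<open>c\<close> of \<open>a\<close> is matched with \<open>b\<close> instead, and the detour from
  \<open>b\<close> to \<open>c\<close> through \<open>a\<close> bounds the new edge.\<close>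

lemma MWM_sym_diff_pair_half:
  assumes S: "finite S" "even (card S)" "S \<subseteq> M"
    and ab: "a \<in> M" "b \<in> M" "a \<in> S" "b \<notin> S"
  shows "MWM d (sym_diff S {a, b}) \<le> MWM d S + d a b"
proof -
  obtain c where c: "c \<in> S" "c \<noteq> a" "MWM d (S - {a, c}) + d a c \<le> MWM d S"
    using MWM_remove[OF S(1,2) ab(3)] by blast
  have "sym_diff S {a, b} = insert b (insert c (S - {a, c}))"
    using c ab by auto
  also have "MWM d \<dots> \<le> MWM d (S - {a, c}) + d b c"
    using c ab S even_card_remove_pair[of S a c] by (intro MWM_insert_le) auto
  also have "d b c \<le> d a b + d a c"
    using triangle''[of b a c] ab c S by auto
  finally show ?thesis
    using c by simp
qed

lemma MWM_sym_diff_pair: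
  assumes S: "finite S" "even (card S)" "S \<subseteq> M" and ab: "a \<in> M" "b \<in> M" "a \<noteq> b"
  shows "MWM d (sym_diff S {a, b}) \<le> MWM d S + d a b"
proof (cases "a \<in> S"; cases "b \<in> S")
  assume "a \<in> S" "b \<notin> S"
  then show ?thesis
    using MWM_sym_diff_pair_half S ab by simp
next
  assume "a \<notin> S" "b \<in> S"
  then show ?thesis
    using MWM_sym_diff_pair_half[of S b a] S ab by (simp add: insert_commute commute)
next
  assume *: "a \<notin> S" "b \<notin> S"
  then have "sym_diff S {a, b} = insert a (insert b S)"
    by auto
  then show ?thesis
    using MWM_insert_le * S ab by simp
next
  assume *: "a \<in> S" "b \<in> S"
  obtain c where c: "c \<in> S" "c \<noteq> a" "MWM d (S - {a, c}) + d a c \<le> MWM d S"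
    using MWM_remove[OF S(1,2) *(1)] by blast
  show ?thesis
  proof (cases "c = b")
    case True
    have "sym_diff S {a, b} = S - {a, c}"
      using True * by auto
    then have "MWM d (sym_diff S {a, b}) = MWM d (S - {a, c})"
      by (rule arg_cong)
    then show ?thesis
      using c(3) nonneg[of a c] nonneg[of a b] by linarith
  next
    \<comment> \<open>Drop the edge from \<open>a\<close> to its partner \<open>c\<close>. What
      remains contains \<open>b\<close> but not \<open>c\<close>, and trading \<open>b\<close> for
      \<open>c\<close> leaves exactly \<open>S\<close> without \<open>a\<close> and
      \<open>b\<close>. The saved length \<open>d a c\<close> pays for the second leg of the detour
      from \<open>b\<close> to \<open>c\<close>.\<close>
    case False
    have "MWM d (sym_diff (S - {a, c}) {b, c}) \<le> MWM d (S - {a, c}) + d b c"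
      using False c * S ab even_card_remove_pair[of S a c]
      by (intro MWM_sym_diff_pair_half) auto
    moreover have "sym_diff (S - {a, c}) {b, c} = sym_diff S {a, b}"
      using False c * ab by auto
    moreover have "d b c \<le> d a b + d a c"
      using triangle''[of b a c] ab c S by auto
    ultimately show ?thesis
      using c by simp
  qed
qed

text \<open>Peel the edges of an optimal matching of \<open>B\<close> off one by one; each changes
  the symmetric difference by a pair and costs at most its own length.\<close>

lemma MWM_sym_diff_le:
  assumes "finite A" "even (card A)" "A \<subseteq> M" "finite B" "even (card B)" "B \<subseteq> M"
  shows "MWM d (sym_diff A B) \<le> MWM d A + MWM d B"
  using assms
proof (induction "card B" arbitrary: A B rule: less_induct)
  case less
  show ?case
  proof (cases "B = {}")
    case False
    then obtain a where a: "a \<in> B" by auto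
    obtain b where b: "b \<in> B" "b \<noteq> a" "MWM d (B - {a, b}) + d a b \<le> MWM d B"
      using MWM_remove[OF _ _ a] less.prems by blast
    define B' where "B' = B - {a, b}"
    have card: "card B = card B' + 2"
      unfolding B'_def using less.prems a b by (intro card_remove_pair) auto
    have B': "finite B'" "even (card B')" "B' \<subseteq> M"
      using less.prems a b even_card_remove_pair[of B a b] unfolding B'_def by auto
    have "sym_diff A B = sym_diff (sym_diff A B') {a, b}"
      unfolding B'_def using a b by auto
    also have "MWM d \<dots> \<le> MWM d (sym_diff A B') + d a b"
      using less.prems a b B' even_card_sym_diff[of A B']
      by (intro MWM_sym_diff_pair) auto
    also have "MWM d (sym_diff A B') \<le> MWM d A + MWM d B'"
      using less.prems card B' by (intro less.hyps) auto
    finally show ?thesis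
      using b unfolding B'_def by simp
  qed simp
qed

text \<open>A perfect matching has \<open>card S / 2\<close> edges, each of length at least
  \<open>r\<close>. For the GMM points, this lets their own matching cost absorb every later error
  of order \<open>k * r\<close>.\<close>

lemma MWM_separated_ge:
  assumes "finite S" "even (card S)" "\<And>x y. x \<in> S \<Longrightarrow> y \<in> S \<Longrightarrow> x \<noteq> y \<Longrightarrow> r \<le> d x y"
  shows "real (card S) * r \<le> 2 * MWM d S"
  using assms
proof (induction "card S" arbitrary: S rule: less_induct)
  case less
  show ?case
  proof (cases "S = {}")
    case False
    then obtain a where a: "a \<in> S" by auto
    obtain b where b: "b \<in> S" "b \<noteq> a" "MWM d (S - {a, b}) + d a b \<le> MWM d S"
      using MWM_remove[OF _ _ a] less.prems by blast
    have card: "card S = card (S - {a, b}) + 2"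
      using less.prems a b by (intro card_remove_pair) auto
    then have "real (card (S - {a, b})) * r \<le> 2 * MWM d (S - {a, b})"
      using less.prems a b even_card_remove_pair[of S a b] by (intro less.hyps) auto
    moreover have "r \<le> d a b"
      using less.prems a b by auto
    ultimately show ?thesis
      using b unfolding card by (simp add: distrib_right)
  qed simp
qed

section \<open>Greedy separation and covering\<close>

lemma point_set_dist_le:
  assumes "finite S" "s \<in> S"
  shows "point_set_dist d x S \<le> d x s"
  unfolding point_set_dist_def using assms by (intro Min_le) auto

lemma point_set_dist_attained:
  assumes "finite S" "S \<noteq> {}"
  obtains s where "s \<in> S" "point_set_dist d x S = d x s"
proof -
  have "point_set_dist d x S \<in> {d x s | s. s \<in> S}"
    unfolding point_set_dist_def using assms by (intro Min_in) auto
  then show thesis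
    using that by auto
qed

lemma point_set_dist_antimono:
  assumes "finite T" "S \<subseteq> T" "S \<noteq> {}"
  shows "point_set_dist d x T \<le> point_set_dist d x S"
  by (rule point_set_dist_attained[of S x])
    (use assms in \<open>auto intro: finite_subset point_set_dist_le\<close>)

text \<open>The radius is the distance of the last pick from its predecessors. It was the farthest
  point at that moment, which gives covering; every earlier pick was at least as far from its own
  predecessors, which gives separation.\<close>

lemma gmm_radius:
  assumes X: "X \<subseteq> M" "finite X" "k \<le> card X" and k: "even k" and valid: "valid_choices d X k ch"
  obtains r where "0 \<le> r" "card (gmm_set ch) = k"
    "\<And>x y. x \<in> gmm_set ch \<Longrightarrow> y \<in> gmm_set ch \<Longrightarrow> x \<noteq> y \<Longrightarrow> r \<le> d x y"
    "\<And>x. x \<in> X \<Longrightarrow> d x (gmm_seq ch ! part_of ch x) \<le> r"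
proof (cases "k = 0")
  case True
  \<comment> \<open>No part index lies below 0, so valid choices exist only for empty
    \<open>X\<close>.\<close>
  then have "X = {}" "gmm_set ch = {}"
    using valid by (auto simp: valid_choices_def gmm_output_def is_arg_min_def gmm_set_def)
  then show thesis
    using True that[of 0] by auto
next
  case False
  with k have k2: "2 \<le> k"
    by presburger
  define ys where "ys = gmm_seq ch"
  define D where "D x p = point_set_dist d x (set (take p ys))" for x p
  \<comment> \<open>Positions start at 0: \<open>ys ! (k - 1)\<close> is the last pick and the first
    \<open>k - 1\<close> entries are its predecessors.\<close>
  define r where "r = D (ys ! (k - 1)) (k - 1)"
  have ys: "length ys = k" "set ys \<subseteq> X"
    using valid by (auto simp: valid_choices_def gmm_output_def ys_def)
  have ne: "set (take p ys) \<noteq> {}" if "1 \<le> p" for p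
    using that ys k2 by auto
  have greedy: "D x p \<le> D (ys ! p) p" if "1 \<le> p" "p < k" "x \<in> X" for x p
  proof -
    have "is_arg_max (\<lambda>y. D y p) (\<lambda>y. y \<in> X) (ys ! p)"
      using valid that unfolding valid_choices_def gmm_output_def ys_def D_def by blast
    then show ?thesis
      using that by (auto simp: is_arg_max_def not_less)
  qed
  have D_antimono: "D x q \<le> D x p" if "1 \<le> p" "p \<le> q" for x p q
    unfolding D_def using that ne[of p] set_take_subset_set_take[of p q ys]
    by (intro point_set_dist_antimono) auto
  have nearest: "\<exists>s\<in>set (take (k - 1) ys). D x (k - 1) = d x s" for x
    unfolding D_def
    by (rule point_set_dist_attained[of "set (take (k - 1) ys)" x]) (use ne[of "k - 1"] k2 in auto)
  have cover: "D x (k - 1) \<le> r" if "x \<in> X" for x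
    unfolding r_def using that k2 by (intro greedy) auto
  have sep: "r \<le> d (ys ! j) (ys ! i)" if "i < j" "j < k" for i j
  proof -
    \<comment> \<open>With fewer predecessors the last pick was at least as far away, and it was
      already a candidate at step \<open>j\<close>, where \<open>ys ! j\<close> was
      preferred.\<close>
    have "r \<le> D (ys ! (k - 1)) j"
      unfolding r_def using that by (intro D_antimono) auto
    also have "\<dots> \<le> D (ys ! j) j"
      using that ys k2 by (intro greedy) auto
    also have "\<dots> \<le> d (ys ! j) (ys ! i)"
      unfolding D_def using that ys by (intro point_set_dist_le) (auto simp: in_set_conv_nth)
    finally show ?thesis .
  qed
  \<comment> \<open>The maximum in GMM ranges over all of \<open>X\<close>, including earlier picks.
    Only a positive radius excludes repetitions; it comes from a point of \<open>X\<close> outside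
    the first \<open>k - 1\<close> picks.\<close>
  have "0 < r"
  proof -
    have "card (set (take (k - 1) ys)) < card X"
      using card_length[of "take (k - 1) ys"] X(3) k2 by auto
    then obtain x where x: "x \<in> X" "x \<notin> set (take (k - 1) ys)"
      by (metis card_mono List.finite_set leD subsetI)
    obtain s where s: "s \<in> set (take (k - 1) ys)" "D x (k - 1) = d x s"
      using nearest by blast
    have "s \<in> X"
      using s ys by (meson in_mono in_set_takeD)
    then have "d x s \<noteq> 0"
      using x s X(1) by (metis subsetD zero)
    then have "0 < d x s"
      using nonneg[of x s] by linarith
    then show ?thesis
      using s cover[OF x(1)] by linarith
  qed
  have ne_nth: "ys ! i \<noteq> ys ! j" if "i < j" "j < k" for i j
  proof
    assume "ys ! i = ys ! j"
    moreover have "ys ! i \<in> M"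
      using ys X(1) that by (metis nth_mem order_less_trans subsetD)
    ultimately show False
      using sep[OF that] \<open>0 < r\<close> zero[of "ys ! i" "ys ! i"] by simp
  qed
  have "distinct ys"
    unfolding distinct_conv_nth ys by (metis ne_nth linorder_neqE_nat)
  then have "card (gmm_set ch) = k"
    using distinct_card[of ys] ys(1) by (simp add: gmm_set_def ys_def)
  moreover have "r \<le> d x y" if xy: "x \<in> gmm_set ch" "y \<in> gmm_set ch" "x \<noteq> y" for x y
  proof -
    obtain i j where ij: "i < k" "j < k" "x = ys ! i" "y = ys ! j"
      using xy ys by (auto simp: gmm_set_def ys_def[symmetric] in_set_conv_nth)
    then show ?thesis
      using xy sep[of i j] sep[of j i] commute[of x y] by (metis linorder_neqE_nat)
  qed
  moreover have "d x (gmm_seq ch ! part_of ch x) \<le> r" if x: "x \<in> X" for x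
  proof -
    obtain s where s: "s \<in> set (take (k - 1) ys)" "D x (k - 1) = d x s"
      using nearest by blast
    then obtain j where "j < k" "s = ys ! j"
      using ys(1) by (metis in_set_conv_nth in_set_takeD)
    then have "d x (gmm_seq ch ! part_of ch x) \<le> d x s"
      using valid x unfolding valid_choices_def is_arg_min_def ys_def by (meson not_less)
    also have "\<dots> \<le> r"
      using cover[OF x] s by simp
    finally show ?thesis .
  qed
  ultimately show thesis
    using that[of r] \<open>0 < r\<close> by simp
qed

text \<open>Pushing every point of \<open>A\<close> to its centre and cancelling centres that are hit twice.\<close>

lemma MWM_le_of_cover:
  assumes "finite A" "even (card A)" "A \<subseteq> M" and C: "finite C" "C \<subseteq> M"
    and f: "\<And>x. x \<in> A \<Longrightarrow> f x \<in> C" "\<And>x. x \<in> A \<Longrightarrow> d x (f x) \<le> r" and "0 \<le> r"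
  obtains Q where "Q \<subseteq> C" "even (card Q)" "MWM d A \<le> MWM d Q + real (card A) * r"
proof -
  \<comment> \<open>The witness built by this induction is the set of centres hit an odd number of
    times by \<open>B\<close>. Each \<open>x\<close> in \<open>B\<close> pays for at most one edge,
    from \<open>x\<close> to \<open>f x\<close>.\<close>
  have "\<exists>Q\<subseteq>C. even (card (sym_diff B Q)) \<and> MWM d (sym_diff B Q) \<le> real (card B) * r"
    if "finite B" "B \<subseteq> A" for B
    using that
  proof (induction B rule: finite_induct)
    case empty
    show ?case
      by (rule exI[of _ "{}"]) simp
  next
    case (insert x B)
    then obtain Q where "Q \<subseteq> C" "even (card (sym_diff B Q))"
      "MWM d (sym_diff B Q) \<le> real (card B) * r"
      by auto
    moreover define D where "D = sym_diff B Q"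
    ultimately have Q: "Q \<subseteq> C" "D = sym_diff B Q" "even (card D)"
      "MWM d D \<le> real (card B) * r"
      by simp_all
    have fin: "finite Q" "finite D"
      using insert(1) Q(2) finite_subset[OF Q(1) C(1)] by auto
    have sub: "D \<subseteq> M" "x \<in> M" "f x \<in> M"
      using insert Q C assms(3) f by auto
    \<comment> \<open>Two singletons instead of a pair: they cancel if \<open>x\<close> is its own
      centre, and then nothing changes.\<close>
    define D' where "D' = sym_diff D (sym_diff {x} {f x})"
    have "even (card (sym_diff {x} {f x}))"
      by (subst even_card_sym_diff) auto
    then have "even (card D')"
      unfolding D'_def using Q(3) fin by (subst even_card_sym_diff) auto
    moreover have "MWM d D' \<le> real (card (insert x B)) * r"
    proof (cases "f x = x")
      case True
      then have "D' = D"
        unfolding D'_def by auto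
      then show ?thesis
        using Q insert \<open>0 \<le> r\<close> by (simp add: distrib_right)
    next
      case False
      then have "D' = sym_diff D {x, f x}"
        unfolding D'_def by auto
      then have "MWM d D' \<le> MWM d D + d x (f x)"
        using MWM_sym_diff_pair[of D x "f x"] fin Q(3) sub False by simp
      then show ?thesis
        using Q f(2)[of x] insert by (simp add: distrib_right)
    qed
    moreover have "D' = sym_diff (insert x B) (sym_diff Q {f x})"
      unfolding D'_def Q(2) using insert by auto
    moreover have "sym_diff Q {f x} \<subseteq> C"
      using Q f insert by auto
    ultimately show ?case by metis
  qed
  from this[of A] obtain Q where "Q \<subseteq> C" "even (card (sym_diff A Q))"
    "MWM d (sym_diff A Q) \<le> real (card A) * r"
    using assms(1) by auto
  moreover define D where "D = sym_diff A Q"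
  ultimately have Q: "Q \<subseteq> C" "D = sym_diff A Q" "even (card D)"
    "MWM d D \<le> real (card A) * r"
    by simp_all
  have fin: "finite Q" "finite D"
    using assms(1) Q(2) finite_subset[OF Q(1) C(1)] by auto
  have even: "even (card Q)"
    using even_card_sym_diff[OF \<open>finite A\<close> \<open>finite Q\<close>] Q(2,3) assms(2) by simp
  have "A = sym_diff Q D"
    unfolding Q(2) by auto
  also have "MWM d \<dots> \<le> MWM d Q + MWM d D"
    using fin even Q C assms(3) by (intro MWM_sym_diff_le) auto
  finally show thesis
    using that Q even by simp
qed

section \<open>The algorithm\<close>

text \<open>The loop never gets stuck, by pigeonhole. Two points of one part share a centre within
  \<open>r\<close>, so they are at most \<open>2 * r\<close> apart; undoing an addition therefore
  costs at most \<open>r\<close> per added point.\<close>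

lemma fill_up_correct:
  assumes X: "X \<subseteq> M" "finite X" "3 * k \<le> card X" and k: "even k" and valid: "valid_choices d X k ch"
    and r: "0 \<le> r" "\<And>x. x \<in> X \<Longrightarrow> d x (gmm_seq ch ! part_of ch x) \<le> r"
    and W: "W \<subseteq> X" "even (card W)" "card W \<le> k"
  shows "\<exists>W'. fill_up X k ch Z W = Some W' \<and> W' \<subseteq> X \<and> card W' = k \<and>
    MWM d W \<le> MWM d W' + real (k - card W) * r"
  using W
proof (induction "k - card W" arbitrary: W rule: less_induct)
  case less
  show ?case
  proof (cases "card W < k")
    case False
    then have "card W = k"
      using less.prems by simp
    then show ?thesis
      using less.prems by (subst fill_up.simps) simp
  next
    case True
    have part: "part_of ch x < k" if "x \<in> X" for x
      using valid that by (auto simp: valid_choices_def is_arg_min_def)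
    have ys: "length (gmm_seq ch) = k" "set (gmm_seq ch) \<subseteq> X"
      using valid by (auto simp: valid_choices_def gmm_output_def)
    \<comment> \<open>Fewer than \<open>2 * k\<close> points are excluded, so more than
      \<open>k\<close> remain for only \<open>k\<close> parts.\<close>
    have "\<not> inj_on (part_of ch) (X - (W \<union> gmm_set ch))"
    proof
      assume "inj_on (part_of ch) (X - (W \<union> gmm_set ch))"
      then have "card (X - (W \<union> gmm_set ch)) \<le> card {..<k}"
        using part by (intro card_inj_on_le[where f = "part_of ch"]) auto
      moreover have "card X - card (W \<union> gmm_set ch) \<le> card (X - (W \<union> gmm_set ch))"
        using less.prems X(2) by (intro diff_card_le_card_Diff) (auto simp: gmm_set_def finite_subset)
      moreover have "card (W \<union> gmm_set ch) \<le> card W + k"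
        using card_Un_le[of W "gmm_set ch"] card_length[of "gmm_seq ch"] ys
        by (simp add: gmm_set_def)
      ultimately show False
        using X(3) True by simp
    qed
    then obtain p where "addable X ch W p"
      unfolding inj_on_def addable_def by (metis fst_conv snd_conv)
    then have add: "addable X ch W (pair ch Z W)"
      using valid unfolding valid_choices_def by blast
    obtain a b where ab: "pair ch Z W = (a, b)"
      by fastforce
    have ab': "a \<noteq> b" "a \<in> X" "b \<in> X" "a \<notin> W" "b \<notin> W" "part_of ch a = part_of ch b"
      using add ab by (auto simp: addable_def)
    define V where "V = W \<union> {a, b}"
    have finW: "finite W"
      using less.prems X(2) finite_subset by blast
    have card: "card V = card W + 2"
      unfolding V_def using ab' finW by simp
    \<comment> \<open>As \<open>k\<close> and \<open>card W\<close> are both even, adding two points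
      cannot overshoot \<open>k\<close>.\<close>
    have V: "V \<subseteq> X" "even (card V)" "card V \<le> k"
      using ab' less.prems card True k unfolding V_def by (auto elim!: evenE)
    have "k - card V < k - card W"
      using card True by simp
    from less.hyps[OF this V] obtain W' where W': "fill_up X k ch Z V = Some W'" "W' \<subseteq> X" "card W' = k"
      "MWM d V \<le> MWM d W' + real (k - card V) * r"
      by blast
    have "fill_up X k ch Z W = Some W'"
      using True add ab W'(1) by (subst fill_up.simps) (simp add: V_def)
    moreover have "MWM d W \<le> MWM d W' + real (k - card W) * r"
    proof -
      have "gmm_seq ch ! part_of ch a \<in> M"
        using ys part[OF ab'(2)] X(1) by (metis nth_mem subsetD)
      then have "d a b \<le> d a (gmm_seq ch ! part_of ch a) + d b (gmm_seq ch ! part_of ch a)"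
        using ab' X(1) by (intro triangle') auto
      also have "\<dots> \<le> r + r"
        using r(2)[OF ab'(2)] r(2)[OF ab'(3)] ab'(6) by simp
      finally have "d a b \<le> 2 * r" by simp
      \<comment> \<open>The bound is needed backwards: \<open>W\<close> arises from the larger set
        \<open>V\<close> by toggling the pair.\<close>
      moreover have "sym_diff V {a, b} = W"
        unfolding V_def using ab' by auto
      then have "MWM d W \<le> MWM d V + d a b"
        using MWM_sym_diff_pair[of V a b] V ab' X(1) finW by (simp add: V_def subset_iff)
      moreover have "real (k - card W) = real (k - card V) + 2"
        using card V(3) by simp
      ultimately show ?thesis
        using W'(4) by (simp add: distrib_right)
    qed
    ultimately show ?thesis
      using W' by blast
  qed
qed

section \<open>A single run\<close>

lemma MWMOffline_eq_map_pmf: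
  "MWMOffline d X k ch =
     map_pmf (\<lambda>Z. map_option (better d (gmm_set ch)) (fill_up X k ch Z (make_even ch Z)))
       (pmf_of_set (Pow (gmm_set ch)))"
  by (simp add: MWMOffline_def map_pmf_def)

lemma better_cases: "better d A B = A \<or> better d A B = B"
  by (simp add: better_def)

lemma MWM_better: "MWM d A \<le> MWM d (better d A B)" "MWM d B \<le> MWM d (better d A B)"
  by (simp_all add: better_def)

lemma remote_matching_attained:
  assumes "finite X" "k \<le> card X"
  obtains A where "A \<subseteq> X" "card A = k" "remote_matching d k X = MWM d A"
proof -
  obtain B where "B \<subseteq> X" "card B = k"
    using obtain_subset_with_card_n[OF assms(2)] by auto
  moreover have "finite (MWM d ` {A. A \<subseteq> X \<and> card A = k})"
    using assms(1) by simp
  ultimately have "Max (MWM d ` {A. A \<subseteq> X \<and> card A = k}) \<in> MWM d ` {A. A \<subseteq> X \<and> card A = k}"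
    by (intro Max_in) auto
  then have "remote_matching d k X \<in> MWM d ` {A. A \<subseteq> X \<and> card A = k}"
    by (simp add: remote_matching_def setcompr_eq_image)
  then show thesis
    using that by auto
qed

text \<open>The size of the output is certain, not merely likely; comparing the outputs of several
  runs relies on this.\<close>

lemma set_pmf_MWMOffline:
  assumes X: "X \<subseteq> M" "finite X" "3 * k \<le> card X" and k: "even k" and valid: "valid_choices d X k ch"
  shows "set_pmf (MWMOffline d X k ch) \<subseteq> {Some Z | Z. Z \<subseteq> X \<and> card Z = k}"
proof -
  define Y where "Y = gmm_set ch"
  have "k \<le> card X"
    using X(3) by simp
  then obtain r where r: "0 \<le> r" "card Y = k"
    "\<And>x. x \<in> X \<Longrightarrow> d x (gmm_seq ch ! part_of ch x) \<le> r"
    using gmm_radius[OF X(1,2) _ k valid] unfolding Y_def by blast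
  have Y: "Y \<subseteq> X" "finite Y"
    using valid by (auto simp: Y_def gmm_set_def valid_choices_def gmm_output_def)
  have "map_option (better d Y) (fill_up X k ch Z (make_even ch Z)) \<in> {Some Z | Z. Z \<subseteq> X \<and> card Z = k}"
    if Z: "Z \<subseteq> Y" for Z
  proof -
    have finZ: "finite Z"
      using Z Y(2) finite_subset by blast
    have "even (card (make_even ch Z))"
    proof (cases "odd (card Z)")
      case True
      then have "dropped ch Z \<in> Z"
        using valid Z unfolding valid_choices_def Y_def by blast
      then show ?thesis
        using True finZ by (simp add: make_even_def)
    qed (simp add: make_even_def)
    moreover have sub: "make_even ch Z \<subseteq> Y"
      using Z by (auto simp: make_even_def)
    moreover have "card (make_even ch Z) \<le> k"
      using card_mono[OF Y(2) sub] r(2) by simp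
    ultimately obtain W where "fill_up X k ch Z (make_even ch Z) = Some W" "W \<subseteq> X" "card W = k"
      using fill_up_correct[OF X k valid r(1,3), of "make_even ch Z" Z] Y(1) by auto
    then show ?thesis
      using better_cases[of Y W] Y(1) r(2) by auto
  qed
  moreover have "set_pmf (pmf_of_set (Pow Y)) = Pow Y"
    using Y(2) by (intro set_pmf_of_set) auto
  ultimately show ?thesis
    unfolding MWMOffline_eq_map_pmf Y_def[symmetric] by (simp add: image_subset_iff)
qed

lemma prob_MWMOffline_ge:
  assumes X: "X \<subseteq> M" "finite X" "3 * k \<le> card X" and k: "even k" and valid: "valid_choices d X k ch"
  shows "1 / 4 \<le> measure_pmf.prob (MWMOffline d X k ch) (approx_outputs d X k (1 / 8))"
proof -
  define Y where "Y = gmm_set ch"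
  define g where "g Z = map_option (better d Y) (fill_up X k ch Z (make_even ch Z))" for Z
  have kX: "k \<le> card X"
    using X(3) by simp
  then obtain r where r: "0 \<le> r" "card Y = k"
    "\<And>x y. x \<in> Y \<Longrightarrow> y \<in> Y \<Longrightarrow> x \<noteq> y \<Longrightarrow> r \<le> d x y"
    "\<And>x. x \<in> X \<Longrightarrow> d x (gmm_seq ch ! part_of ch x) \<le> r"
    using gmm_radius[OF X(1,2) _ k valid] unfolding Y_def by blast
  have Y: "Y \<subseteq> X" "finite Y"
    using valid by (auto simp: Y_def gmm_set_def valid_choices_def gmm_output_def)
  have MWM_Y: "real k * r \<le> 2 * MWM d Y"
    using MWM_separated_ge[of Y r] Y(2) r k by simp
  obtain A where A: "A \<subseteq> X" "card A = k" "remote_matching d k X = MWM d A"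
    using remote_matching_attained X(2) kX by blast
  have centre: "gmm_seq ch ! part_of ch x \<in> Y" if "x \<in> X" for x
    using valid that
    by (auto simp: valid_choices_def is_arg_min_def gmm_output_def Y_def gmm_set_def)
  obtain Q where Q: "Q \<subseteq> Y" "even (card Q)" "MWM d A \<le> MWM d Q + real k * r"
  proof (rule MWM_le_of_cover[of A Y "\<lambda>x. gmm_seq ch ! part_of ch x" r])
    show "finite A"
      using A(1) X(2) finite_subset by blast
  qed (use A X Y k r(1,4) centre in auto)
  define P where "P Z \<longleftrightarrow> MWM d Q \<le> 2 * MWM d Z" for Z
  have "P Z \<or> P (sym_diff Z Q)" if Z: "Z \<subseteq> Y" "even (card Z)" for Z
  proof -
    have fin: "finite Z" "finite Q"
      using Z(1) Q(1) Y(2) finite_subset by blast+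
    \<comment> \<open>Subadditivity applied to this identity forces one of the two sets to cost at
      least half of \<open>MWM d Q\<close>.\<close>
    have "Q = sym_diff Z (sym_diff Z Q)"
      by auto
    also have "MWM d \<dots> \<le> MWM d Z + MWM d (sym_diff Z Q)"
      using Z Q Y(1) X(1) fin even_card_sym_diff[OF fin] by (intro MWM_sym_diff_le) auto
    finally show ?thesis
      unfolding P_def by linarith
  qed
  then have "2 ^ card Y \<le> 4 * card {Z. Z \<subseteq> Y \<and> even (card Z) \<and> P Z}"
    using Y(2) Q(1,2) by (intro card_good_subsets_ge)
  \<comment> \<open>For an even \<open>Z\<close> nothing is dropped, so the loop starts from
    \<open>Z\<close> itself.\<close>
  also have "card {Z. Z \<subseteq> Y \<and> even (card Z) \<and> P Z}
      \<le> card (Pow Y \<inter> g -` approx_outputs d X k (1 / 8))"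
  proof (intro card_mono subsetI)
    fix Z assume "Z \<in> {Z. Z \<subseteq> Y \<and> even (card Z) \<and> P Z}"
    then have Z: "Z \<subseteq> Y" "even (card Z)" "MWM d Q \<le> 2 * MWM d Z"
      by (auto simp: P_def)
    have "card Z \<le> k"
      using card_mono[OF Y(2) Z(1)] r(2) by simp
    then obtain W where W: "fill_up X k ch Z Z = Some W" "W \<subseteq> X" "card W = k"
      "MWM d Z \<le> MWM d W + real (k - card Z) * r"
      using fill_up_correct[OF X k valid r(1,4), of Z Z] Z Y(1) by auto
    have "real (k - card Z) * r \<le> real k * r"
      using r(1) by (intro mult_right_mono) auto
    \<comment> \<open>Writing OPT for the remote-matching value: OPT <= 2 MWM(Z) + k r <= 2 MWM(W) +
      3 k r <= 2 MWM(W) + 6 MWM(Y). This is where the constant 8 comes from.\<close>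
    then have "remote_matching d k X \<le> 8 * MWM d (better d Y W)"
      using A(3) Q(3) Z(3) W(4) MWM_Y MWM_better(1)[of Y W] MWM_better(2)[of W Y] by linarith
    moreover have "better d Y W \<subseteq> X" "card (better d Y W) = k"
      using better_cases[of Y W] Y(1) r(2) W by auto
    moreover have "g Z = Some (better d Y W)"
      using W(1) Z(2) by (simp add: g_def make_even_def)
    ultimately show "Z \<in> Pow Y \<inter> g -` approx_outputs d X k (1 / 8)"
      using Z(1) by (auto simp: approx_outputs_def)
  qed (use Y in auto)
  finally have "2 ^ card Y \<le> 4 * card (Pow Y \<inter> g -` approx_outputs d X k (1 / 8))"
    by simp
  then have "real (2 ^ card Y) \<le> real (4 * card (Pow Y \<inter> g -` approx_outputs d X k (1 / 8)))"
    by (rule of_nat_mono)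
  moreover have "measure_pmf.prob (MWMOffline d X k ch) (approx_outputs d X k (1 / 8)) =
      real (card (Pow Y \<inter> g -` approx_outputs d X k (1 / 8))) / 2 ^ card Y"
    unfolding MWMOffline_eq_map_pmf Y_def[symmetric] g_def[symmetric] measure_map_pmf
    using Y(2) by (subst measure_pmf_of_set) (auto simp: card_Pow)
  ultimately show ?thesis
    by (simp only:) (simp add: field_simps)
qed

section \<open>Independent repetition\<close>

lemma approx_outputs_better_output:
  assumes "u \<in> insert None {Some Z | Z. Z \<subseteq> X \<and> card Z = k}"
    and "v \<in> insert None {Some Z | Z. Z \<subseteq> X \<and> card Z = k}"
    and "u \<in> approx_outputs d X k c \<or> v \<in> approx_outputs d X k c"
  shows "better_output d u v \<in> approx_outputs d X k c"
  using assms by (cases u; cases v) (auto simp: approx_outputs_def better_def)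

text \<open>The combined run fails only if all runs fail, so independence multiplies the failure
  probabilities. The support is carried through the induction because a competing output may replace
  a good one only if it is itself a \<open>k\<close>-subset of \<open>X\<close>; \<open>None\<close>
  occurs for zero runs.\<close>

lemma prob_MWMOffline_repeated:
  assumes X: "X \<subseteq> M" "finite X" "3 * k \<le> card X" and k: "even k"
    and valid: "\<And>i. i < t \<Longrightarrow> valid_choices d X k (chs i)"
  shows "set_pmf (MWMOffline_repeated d X k chs t) \<subseteq> insert None {Some Z | Z. Z \<subseteq> X \<and> card Z = k}
    \<and> measure_pmf.prob (MWMOffline_repeated d X k chs t) (- approx_outputs d X k (1 / 8)) \<le> (3 / 4) ^ t"
  using valid
proof (induction t)
  case 0
  show ?case by simp
next
  case (Suc t)
  define S where "S = insert None {Some Z | Z. Z \<subseteq> X \<and> card Z = k}"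
  define R where "R = MWMOffline_repeated d X k chs t"
  define N where "N = MWMOffline d X k (chs t)"
  define F where "F = - approx_outputs d X k (1 / 8)"
  have R: "set_pmf R \<subseteq> S" "measure_pmf.prob R F \<le> (3 / 4) ^ t"
    using Suc by (auto simp: R_def F_def S_def)
  have N: "set_pmf N \<subseteq> S"
    using set_pmf_MWMOffline[OF X k Suc.prems[of t]] by (auto simp: N_def S_def)
  have "measure_pmf.prob N F = 1 - measure_pmf.prob N (approx_outputs d X k (1 / 8))"
    unfolding F_def using measure_pmf.prob_compl[of "approx_outputs d X k (1 / 8)" N]
    by (simp add: Compl_eq_Diff_UNIV)
  then have prob_N: "measure_pmf.prob N F \<le> 3 / 4"
    using prob_MWMOffline_ge[OF X k Suc.prems[of t]] by (simp add: N_def)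
  have eq: "MWMOffline_repeated d X k chs (Suc t) =
      map_pmf (\<lambda>(u, v). better_output d u v) (pair_pmf R N)"
    by (simp add: R_def N_def map_pmf_def pair_pmf_def bind_assoc_pmf bind_return_pmf)
  have "better_output d u v \<in> S" if "u \<in> S" "v \<in> S" for u v
    using that by (cases u; cases v) (auto simp: better_def S_def)
  then have "set_pmf (MWMOffline_repeated d X k chs (Suc t)) \<subseteq> S"
    unfolding eq using R(1) N by (auto simp: subset_iff)
  moreover have "measure_pmf.prob (MWMOffline_repeated d X k chs (Suc t)) F \<le> (3 / 4) ^ Suc t"
  proof -
    let ?B = "(\<lambda>(u, v). better_output d u v) -` F"
    have "measure_pmf.prob (MWMOffline_repeated d X k chs (Suc t)) F =
        measure_pmf.prob (pair_pmf R N) ?B"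
      unfolding eq by simp
    \<comment> \<open>Intersecting with the support makes the shape of both outputs available; only
      then does failure of the better output imply failure of both.\<close>
    also have "\<dots> = measure_pmf.prob (pair_pmf R N) (?B \<inter> set_pmf (pair_pmf R N))"
      by (simp only: measure_Int_set_pmf)
    also have "\<dots> \<le> measure_pmf.prob (pair_pmf R N) ((F \<inter> set_pmf R) \<times> (F \<inter> set_pmf N))"
    proof (rule measure_pmf.finite_measure_mono)
      show "?B \<inter> set_pmf (pair_pmf R N) \<subseteq> (F \<inter> set_pmf R) \<times> (F \<inter> set_pmf N)"
        using approx_outputs_better_output[of _ X k _ "1 / 8", folded S_def] R(1) N
        by (auto simp: F_def subset_iff)
    qed simp
    also have "\<dots> = measure_pmf.prob R F * measure_pmf.prob N F"
      by (subst measure_pmf_prob_product) (simp_all add: measure_Int_set_pmf countable_Int2)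
    also have "\<dots> \<le> (3 / 4) ^ t * (3 / 4)"
      using R(2) prob_N by (intro mult_mono) auto
    finally show ?thesis by simp
  qed
  ultimately show ?case
    unfolding S_def F_def ..
qed

end

theorem theorem1:
  "\<exists>c>0. \<forall>(M :: 'a set) (d :: 'a \<Rightarrow> 'a \<Rightarrow> real) (X :: 'a set) (n :: nat) (k :: nat).
     Metric_space M d \<and> X \<subseteq> M \<and> finite X \<and> card X = n \<and> even k \<and> real k \<le> real n / 3 \<longrightarrow>
     (\<forall>ch. valid_choices d X k ch \<longrightarrow>
        measure_pmf.prob (MWMOffline d X k ch) (approx_outputs d X k c) \<ge> 1 / 4) \<and>
     (\<forall>chs t. (\<forall>i<t. valid_choices d X k (chs i)) \<longrightarrow>
        measure_pmf.prob (MWMOffline_repeated d X k chs t) (approx_outputs d X k c)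
          \<ge> 1 - (3 / 4) ^ t)"
proof (rule exI[of _ "1 / 8"], intro conjI allI impI, goal_cases)
  case (2 M d X n k ch)
  then have "Metric_space M d" "3 * k \<le> card X"
    by auto
  with 2 show ?case
    using Metric_space.prob_MWMOffline_ge by blast
next
  case (3 M d X n k chs t)
  then have "Metric_space M d" "3 * k \<le> card X"
    by auto
  \<comment> \<open>Success is bounded through its complement, the event that all \<open>t\<close>
    runs fail.\<close>
  with 3 have "measure_pmf.prob (MWMOffline_repeated d X k chs t) (- approx_outputs d X k (1 / 8))
      \<le> (3 / 4) ^ t"
    using Metric_space.prob_MWMOffline_repeated by blast
  then show ?case
    using measure_pmf.prob_compl[of "approx_outputs d X k (1 / 8)" "MWMOffline_repeated d X k chs t"]
    by (simp add: Compl_eq_Diff_UNIV)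
qed simp

end
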